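(* Let $A$ be a non-empty closed subset of $E^{n}$. If every pair of boundary points of $A$ is flat, then $A$ and its boundary $\partial A$ are both convex sets. Moreover, if in addition $A$ has non-empty interior, then $A$ is unbounded, $\partial A$ is affine, and the complement $A^{c}$ is convex.
   Context: $E^{n}$ is the $n$-dimensional Euclidean space, $n\ge 1$. For $A\subset E^n$, $\partial A$ and $A^{c}=E^n\setminus A$ denote the boundary and complement of $A$. For points $p,q$, $[pq]$ is the closed segment joining them and $(pq)=[pq]\setminus\{p,q\}$ is the open segment. A pair of distinct boundary points $p,q\in\partial A$ is called flat (or parabolic) if $(pq)\subset \partial A$; "every pair of boundary points" means every pair of distinct points of $\partial A$. A set $S\subset E^n$ is affine if for all distinct $x,y\in S$ the whole line through $x$ and $y$ lies in $S$ (so the empty set and singletons are affine). The empty set is regarded as convex. *)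

theory Defs
  imports "HOL-Analysis.Analysis"
begin

definition flat_pair :: "(real ^ 'n) set \<Rightarrow> real ^ 'n \<Rightarrow> real ^ 'n \<Rightarrow> bool" where
  "flat_pair A p q \<longleftrightarrow>
     p \<in> frontier A \<and> q \<in> frontier A \<and> p \<noteq> q \<and> open_segment p q \<subseteq> frontier A"

end

theory Submission imports Defs begin

text \<open>
  The boundary \<open>F\<close> is convex, and being the boundary of a closed set it has empty interior, so it
  lies in a hyperplane. The two open half-spaces bounded by this hyperplane are connected and
  miss \<open>F\<close>, so each of them lies inside \<open>A\<close> or is disjoint from \<open>A\<close>. If \<open>A\<close> has interior points
  and is not the whole space, exactly one of them lies inside \<open>A\<close>, and \<open>A\<close> is its closure.
\<close>

text \<open>A connected set that meets both \<open>A\<close> and its complement must cross the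
  frontier.\<close>

lemma subset_or_disjoint_if_disjoint_frontier:
  assumes "connected S" and "S \<inter> frontier A = {}"
  shows "S \<subseteq> A \<or> S \<inter> A = {}"
  using connected_Int_frontier[OF assms(1), of A] assms(2) by blast

text \<open>Closedness puts the frontier inside \<open>A\<close>, so its interior points would be
  interior to \<open>A\<close>, and the frontier excludes those.\<close>

lemma interior_frontier_closed:
  assumes "closed A"
  shows "interior (frontier A) = {}"
proof -
  have "interior (frontier A) \<subseteq> interior A"
    using assms by (intro interior_mono frontier_subset_closed)
  then show ?thesis
    using interior_subset[of "frontier A"] by (auto simp: frontier_def)
qed

lemma unbounded_halfspace_le:
  fixes a :: "'a::euclidean_space"
  assumes "a \<noteq> 0"
  shows "\<not> bounded {x. a \<bullet> x \<le> b}"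
proof
  assume "bounded {x. a \<bullet> x \<le> b}"
  then obtain B where B: "\<And>x. a \<bullet> x \<le> b \<Longrightarrow> norm x \<le> B"
    by (auto simp: bounded_iff)
  \<comment> \<open>The point \<open>- (t *\<^sub>R a)\<close> is the counterexample to the bound
    \<open>B\<close>: the term with \<open>b\<close> puts it in the half-space, the other two make
    its norm at least \<open>\<bar>B\<bar> + 1\<close>.\<close>
  define t where "t = (\<bar>b\<bar> + \<bar>B\<bar> * norm a + norm a) / (a \<bullet> a)"
  have pos: "a \<bullet> a > 0" "norm a > 0"
    using assms by auto
  then have ta: "t * (a \<bullet> a) = \<bar>b\<bar> + \<bar>B\<bar> * norm a + norm a"
    by (simp add: t_def)
  have "t \<ge> 0"
    using pos unfolding t_def by simp
  have "a \<bullet> (- (t *\<^sub>R a)) = - (\<bar>b\<bar> + \<bar>B\<bar> * norm a + norm a)"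
    using ta by simp
  also have "\<dots> \<le> b"
    using pos mult_nonneg_nonneg[of "\<bar>B\<bar>" "norm a"] by linarith
  finally have "norm (- (t *\<^sub>R a)) \<le> B"
    by (rule B)
  then have "t * norm a \<le> B"
    using \<open>t \<ge> 0\<close> by simp
  then have "t * norm a * norm a \<le> B * norm a"
    by (simp add: mult_right_mono)
  moreover have "t * norm a * norm a = \<bar>b\<bar> + \<bar>B\<bar> * norm a + norm a"
    using ta by (simp add: dot_square_norm power2_eq_square)
  moreover have "B * norm a \<le> \<bar>B\<bar> * norm a"
    by (simp add: mult_right_mono)
  ultimately show False
    using pos by linarith
qed

lemma halfspace_if_frontier_subset_hyperplane:
  fixes A :: "'a::euclidean_space set"
  assumes "closed A" and "interior A \<noteq> {}" and "A \<noteq> UNIV"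
    and "a \<noteq> 0" and F: "frontier A \<subseteq> {x. a \<bullet> x = b}"
  obtains c d where "c \<noteq> 0" and "A = {x. c \<bullet> x \<le> d}"
proof -
  have one_side: "{x. c \<bullet> x \<le> d} \<subseteq> A" if "c \<noteq> 0" "{x. c \<bullet> x < d} \<subseteq> A" for c d
    using closure_minimal[OF that(2) \<open>closed A\<close>] that(1) by (simp add: closure_halfspace_lt)
  have below: "{x. a \<bullet> x < b} \<subseteq> A \<or> {x. a \<bullet> x < b} \<inter> A = {}"
    using F by (intro subset_or_disjoint_if_disjoint_frontier convex_connected convex_halfspace_lt)
      auto
  \<comment> \<open>Negating \<open>a\<close> and \<open>b\<close> gives the upper side the same
    form as the lower one, so that \<open>one_side\<close> serves both.\<close>
  have above: "{x. (- a) \<bullet> x < - b} \<subseteq> A \<or> {x. (- a) \<bullet> x < - b} \<inter> A = {}"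
    using F by (intro subset_or_disjoint_if_disjoint_frontier convex_connected convex_halfspace_lt)
      auto
  \<comment> \<open>A hyperplane has empty interior, unlike \<open>A\<close>; hence \<open>A\<close>
    meets at least one open side.\<close>
  have "\<not> A \<subseteq> {x. a \<bullet> x = b}"
    using interior_mono[of A "{x. a \<bullet> x = b}"] assms(2,4) by auto
  then obtain x where "x \<in> A" "a \<bullet> x < b \<or> (- a) \<bullet> x < - b"
    by (force simp: linorder_neq_iff)
  then have "\<not> ({x. a \<bullet> x < b} \<inter> A = {} \<and> {x. (- a) \<bullet> x < - b} \<inter> A = {})"
    by blast
  then consider (both) "{x. a \<bullet> x < b} \<subseteq> A" "{x. (- a) \<bullet> x < - b} \<subseteq> A"
    | (lt) "{x. a \<bullet> x < b} \<subseteq> A" "{x. (- a) \<bullet> x < - b} \<inter> A = {}"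
    | (gt) "{x. (- a) \<bullet> x < - b} \<subseteq> A" "{x. a \<bullet> x < b} \<inter> A = {}"
    using below above by blast
  then show thesis
  proof cases
    case both
    \<comment> \<open>The closed lower side and the open upper side cover the space.\<close>
    then have "A = UNIV"
      using one_side[of a b] \<open>a \<noteq> 0\<close> by force
    with \<open>A \<noteq> UNIV\<close> show ?thesis ..
  next
    case lt
    then have "A = {x. a \<bullet> x \<le> b}"
      using one_side[of a b] \<open>a \<noteq> 0\<close> by force
    then show ?thesis
      using that \<open>a \<noteq> 0\<close> by blast
  next
    case gt
    then have "A = {x. (- a) \<bullet> x \<le> - b}"
      using one_side[of "- a" "- b"] \<open>a \<noteq> 0\<close> by force
    then show ?thesis
      using that[of "- a" "- b"] \<open>a \<noteq> 0\<close> by simp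
  qed
qed

theorem theorem2:
  fixes A :: "(real ^ 'n) set"
  assumes "A \<noteq> {}" and "closed A"
    and "\<forall>p \<in> frontier A. \<forall>q \<in> frontier A. p \<noteq> q \<longrightarrow> flat_pair A p q"
  shows "convex A \<and> convex (frontier A) \<and>
    (interior A \<noteq> {} \<longrightarrow> \<not> bounded A \<and> affine (frontier A) \<and> convex (- A))"
proof -
  have convF: "convex (frontier A)"
    unfolding convex_contains_open_segment
    \<comment> \<open>Flatness concerns distinct points only; for equal points the open segment is
      empty.\<close>
    using assms(3) by (metis flat_pair_def open_segment_idem empty_subsetI)
  show ?thesis
  proof (cases "interior A = {}")
    case True
    then have "frontier A = A"
      using \<open>closed A\<close> by (simp add: frontier_def)
    then show ?thesis
      using convF True by simp
  next
    case int: False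
    show ?thesis
    \<comment> \<open>The whole space is not a half-space and is treated apart: its frontier and
      complement are empty.\<close>
    proof (cases "A = UNIV")
      case True
      then show ?thesis
        using not_bounded_UNIV by simp
    next
      case False
      obtain a b where "a \<noteq> 0" "frontier A \<subseteq> {x. a \<bullet> x = b}"
        using empty_interior_subset_hyperplane[OF convF interior_frontier_closed[OF \<open>closed A\<close>]]
        by metis
      then obtain c d where c: "c \<noteq> 0" and A: "A = {x. c \<bullet> x \<le> d}"
        using halfspace_if_frontier_subset_hyperplane[OF \<open>closed A\<close> int False] by metis
      have "- A = {x. c \<bullet> x > d}"
        using A by auto
      moreover have "frontier A = {x. c \<bullet> x = d}"
        using A c by (simp add: frontier_halfspace_le)
      ultimately show ?thesis
        using A c convF
        by (simp add: convex_halfspace_le convex_halfspace_gt affine_hyperplane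
            unbounded_halfspace_le)
    qed
  qed
qed

end
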